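(* Let $n\ge 1$ be an integer and let $R_n(F_k)$ be the $n\times n$ matrix whose $(i,j)$-entry is $1/F_{i+j-1}$ for $1\le i,j\le n$, where $F_k$ is the $k$-th Fibonacci number. Let $e(n,i,j)=n(i+j+1)+\binom{i}{2}+\binom{j}{2}+1$, and let $W(n)$ be the $n\times n$ matrix whose $(i,j)$-entry ($1\le i,j\le n$) is $$W_{ij}(n)=(-1)^{e(n,i,j)}\,F_{i+j-1}\left(\!\binom{n+i-1}{n-j}\!\right)\left(\!\binom{n+j-1}{n-i}\!\right)\left(\!\binom{i+j-2}{i-1}\!\right)^2,$$ where $\left(\!\binom{a}{b}\!\right)$ denotes the Fibonomial coefficient. Then $W(n)$ is the inverse of $R_n(F_k)$, and all entries of $W(n)$ are integers.
   Context: The Fibonacci numbers are $F_0=0$, $F_1=1$, $F_k=F_{k-1}+F_{k-2}$ for $k\ge 2$. For nonnegative integers $a,b$, the Fibonomial coefficient is $\left(\!\binom{a}{b}\!\right)=\prod_{t=1}^{b}\frac{F_{a-t+1}}{F_t}$ (equal to $1$ when $b=0$). *)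

theory Defs
  imports "HOL-Number_Theory.Fib" "Jordan_Normal_Form.Matrix"
begin

text \<open>The index is written \<open>a + 1 - t\<close> so that truncated subtraction is harmless: for \<open>b > a\<close> the
  factor with \<open>t = a + 1\<close> is \<open>fib 0 = 0\<close>, so the whole product vanishes.\<close>

definition fibonomial :: "nat \<Rightarrow> nat \<Rightarrow> rat" where
  "fibonomial a b = (\<Prod>t = 1..b. of_nat (fib (a + 1 - t)) / of_nat (fib t))"

text \<open>Matrix indices start at 0, so the entry in position \<open>(i, j)\<close> of a matrix is the
  mathematical \<open>(i + 1, j + 1)\<close> entry; \<open>W_exponent\<close> and \<open>W_entry\<close> take indices starting at 1.\<close>

definition R_mat :: "nat \<Rightarrow> rat mat" where
  "R_mat n = mat n n (\<lambda>(i, j). 1 / of_nat (fib ((i + 1) + (j + 1) - 1)))"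

definition W_exponent :: "nat \<Rightarrow> nat \<Rightarrow> nat \<Rightarrow> nat" where
  "W_exponent n i j = n * (i + j + 1) + (i choose 2) + (j choose 2) + 1"

definition W_entry :: "nat \<Rightarrow> nat \<Rightarrow> nat \<Rightarrow> rat" where
  "W_entry n i j =
     (- 1) ^ W_exponent n i j * of_nat (fib (i + j - 1))
       * fibonomial (n + i - 1) (n - j) * fibonomial (n + j - 1) (n - i)
       * (fibonomial (i + j - 2) (i - 1))\<^sup>2"

definition W_mat :: "nat \<Rightarrow> rat mat" where
  "W_mat n = mat n n (\<lambda>(i, j). W_entry n (i + 1) (j + 1))"

end

theory Submission
  imports Defs "Jordan_Normal_Form.Determinant"
begin

text \<open>
  Put \<open>u\<^sub>i = (F\<^bsub>i+1\<^esub>, F\<^sub>i)\<close> and \<open>v\<^sub>k = (- F\<^sub>k, F\<^bsub>k+1\<^esub>)\<close> for indices starting at 0. By the addition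
  theorem, the \<open>2 \<times> 2\<close> determinants satisfy \<open>[u\<^sub>i, v\<^sub>k] = F\<^bsub>i+k+1\<^esub>\<close>, so the matrix of reciprocal
  Fibonacci numbers is a homogeneous Cauchy matrix. Its inverse comes from the homogeneous form of
  the vanishing of divided differences on polynomials of low degree: the sum over the points
  \<open>v\<^sub>k\<close> of \<open>\<Prod>\<^sub>l [u\<^sub>l, v\<^sub>k] / \<Prod>\<^bsub>m\<noteq>k\<^esub> [v\<^sub>k, v\<^sub>m]\<close> is zero if there are two fewer factors
  \<open>u\<^sub>l\<close> than points. Off the diagonal this is applied to the points \<open>v\<^sub>k\<close>, on the diagonal to the
  points \<open>v\<^sub>k\<close> together with \<open>u\<^sub>j\<close>.
\<close>

subsection \<open>A homogeneous Lagrange identity\<close>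

definition bracket :: "'a::comm_ring \<times> 'a \<Rightarrow> 'a \<times> 'a \<Rightarrow> 'a" where
  "bracket p q = fst p * snd q - snd p * fst q"

lemma bracket_swap: "bracket q p = - bracket p q"
  by (simp add: bracket_def algebra_simps)

lemma bracket_self [simp]: "bracket p p = 0"
  by (simp add: bracket_def algebra_simps)

text \<open>Three vectors in the plane are linearly dependent: for independent \<open>a\<close> and
  \<open>b\<close> this expands \<open>bracket u w\<close> in \<open>bracket a w\<close> and
  \<open>bracket b w\<close>.\<close>

lemma bracket_pluecker:
  "bracket u w * bracket a b = bracket u b * bracket a w - bracket u a * bracket b w"
  by (simp add: bracket_def algebra_simps)

text \<open>The extra factor kills the term \<open>k = a\<close> and elsewhere cancels, up to sign,
  the denominator factor with \<open>m = a\<close>. So it deletes the point \<open>a\<close> from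
  the sum.\<close>

lemma sum_bracket_quotient_remove:
  fixes v :: "'i \<Rightarrow> 'a::field \<times> 'a"
  assumes "finite I" "a \<in> I"
    and "\<And>k m. k \<in> I \<Longrightarrow> m \<in> I \<Longrightarrow> k \<noteq> m \<Longrightarrow> bracket (v k) (v m) \<noteq> 0"
  shows "(\<Sum>k\<in>I. bracket (v a) (v k) * P k / (\<Prod>m\<in>I - {k}. bracket (v k) (v m)))
    = - (\<Sum>k\<in>I - {a}. P k / (\<Prod>m\<in>I - {a} - {k}. bracket (v k) (v m)))"
proof -
  have "bracket (v a) (v k) * P k / (\<Prod>m\<in>I - {k}. bracket (v k) (v m))
      = - (P k / (\<Prod>m\<in>I - {a} - {k}. bracket (v k) (v m)))" if "k \<in> I - {a}" for k
  proof -
    have "(\<Prod>m\<in>I - {k}. bracket (v k) (v m))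
        = bracket (v k) (v a) * (\<Prod>m\<in>I - {k} - {a}. bracket (v k) (v m))"
      using that assms(1,2) by (intro prod.remove) auto
    also have "I - {k} - {a} = I - {a} - {k}" by auto
    moreover have "bracket (v a) (v k) \<noteq> 0" using that assms(2,3) by auto
    ultimately show ?thesis by (simp add: bracket_swap[of "v k" "v a"])
  qed
  then show ?thesis
    by (simp add: sum.remove[OF assms(1,2)] sum_negf)
qed

lemma sum_bracket_quotient_eq_0:
  fixes v :: "'i \<Rightarrow> 'a::field \<times> 'a" and u :: "'j \<Rightarrow> 'a \<times> 'a"
  assumes "finite L" "finite I" "card I = card L + 2"
    and "\<And>k m. k \<in> I \<Longrightarrow> m \<in> I \<Longrightarrow> k \<noteq> m \<Longrightarrow> bracket (v k) (v m) \<noteq> 0"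
  shows "(\<Sum>k\<in>I. (\<Prod>l\<in>L. bracket (u l) (v k)) / (\<Prod>m\<in>I - {k}. bracket (v k) (v m))) = 0"
  using assms
proof (induction L arbitrary: I rule: finite_induct)
  case empty
  then have "card I = 2" by simp
  then obtain a b where I: "I = {a, b}" and "a \<noteq> b"
    by (auto simp only: card_2_iff)
  moreover from \<open>a \<noteq> b\<close> have "{a, b} - {a} = {b}" "{a, b} - {b} = {a}" by auto
  ultimately show ?case
    \<comment> \<open>The two terms are reciprocals of opposite brackets.\<close>
    by (simp add: bracket_swap[of "v b" "v a"])
next
  case (insert l L)
  from insert.prems have "\<not> card I \<le> Suc 0" by simp
  then obtain a b where ab: "a \<in> I" "b \<in> I" "a \<noteq> b"
    using card_le_Suc0_iff_eq[OF insert.prems(1)] by auto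
  define P where "P k = (\<Prod>l\<in>L. bracket (u l) (v k))" for k
  define Q where "Q k = (\<Prod>m\<in>I - {k}. bracket (v k) (v m))" for k
  \<comment> \<open>A factor \<open>bracket (v c) (v k)\<close> in place of
    \<open>bracket (u l) (v k)\<close> leaves one point and one factor fewer, so the induction
    hypothesis applies. The Pluecker relation reduces the general factor to two such,
    \<open>c = a\<close> and \<open>c = b\<close>.\<close>
  have zero: "(\<Sum>k\<in>I. bracket (v c) (v k) * P k / Q k) = 0" if "c \<in> I" for c
  proof -
    have "(\<Sum>k\<in>I - {c}. P k / (\<Prod>m\<in>I - {c} - {k}. bracket (v k) (v m))) = 0"
      unfolding P_def using insert that by (intro insert.IH) auto
    then show ?thesis
      unfolding Q_def using sum_bracket_quotient_remove[of I c v P] insert.prems that by simp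
  qed
  have "bracket (v a) (v b) * (bracket (u l) (v k) * P k / Q k)
      = bracket (u l) (v b) * (bracket (v a) (v k) * P k / Q k)
        - bracket (u l) (v a) * (bracket (v b) (v k) * P k / Q k)" for k
  proof -
    have "bracket (v a) (v b) * (bracket (u l) (v k) * P k / Q k)
        = (bracket (u l) (v k) * bracket (v a) (v b)) * P k / Q k"
      by simp
    then show ?thesis
      by (subst (asm) bracket_pluecker) (simp add: left_diff_distrib diff_divide_distrib mult.assoc)
  qed
  then have "bracket (v a) (v b) * (\<Sum>k\<in>I. bracket (u l) (v k) * P k / Q k)
      = bracket (u l) (v b) * (\<Sum>k\<in>I. bracket (v a) (v k) * P k / Q k)
        - bracket (u l) (v a) * (\<Sum>k\<in>I. bracket (v b) (v k) * P k / Q k)"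
    by (simp only: sum_distrib_left sum_subtractf)
  also have "\<dots> = 0" using zero ab by simp
  finally show ?case
    using insert.prems(3)[of a b] ab insert.hyps by (simp add: P_def Q_def)
qed

subsection \<open>Brackets of consecutive Fibonacci numbers\<close>

definition fib_row :: "nat \<Rightarrow> rat \<times> rat" where
  "fib_row i = (of_nat (fib (Suc i)), of_nat (fib i))"

definition fib_col :: "nat \<Rightarrow> rat \<times> rat" where
  "fib_col k = (- of_nat (fib k), of_nat (fib (Suc k)))"

lemma fib_neq_0: "0 < n \<Longrightarrow> fib n \<noteq> 0"
  using fib_neq_0_nat by simp

lemma bracket_fib_row_col: "bracket (fib_row i) (fib_col k) = of_nat (fib (Suc (i + k)))"
  by (simp add: bracket_def fib_row_def fib_col_def fib_add mult.commute)

text \<open>\<open>fib_col k\<close> is \<open>fib_row k\<close> turned by a right angle, and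
  rotations preserve determinants.\<close>

lemma bracket_fib_col_col: "bracket (fib_col k) (fib_col m) = bracket (fib_row k) (fib_row m)"
  by (simp add: bracket_def fib_row_def fib_col_def)

text \<open>This is d'Ocagne's identity. Raising both indices by one applies the Fibonacci matrix,
  whose determinant is -1.\<close>

lemma bracket_fib_row_row:
  "bracket (fib_row k) (fib_row (k + d)) = (- 1) ^ k * of_nat (fib d)"
proof (induction k)
  case (Suc k)
  have "bracket (fib_row (Suc k)) (fib_row (Suc k + d)) = - bracket (fib_row k) (fib_row (k + d))"
    by (simp add: bracket_def fib_row_def algebra_simps)
  with Suc show ?case by simp
qed (simp add: bracket_def fib_row_def)

lemma bracket_fib_row_row_neq_0:
  assumes "k \<noteq> m"
  shows "bracket (fib_row k) (fib_row m) \<noteq> 0"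
proof -
  have *: "bracket (fib_row k) (fib_row m) \<noteq> 0" if "k < m" for k m
    using bracket_fib_row_row[of k "m - k"] that fib_neq_0[of "m - k"] by simp
  show ?thesis
    using assms *[of k m] *[of m k] bracket_swap[of "fib_row k" "fib_row m"]
    by (cases "k < m") auto
qed

subsection \<open>Fibonomial coefficients\<close>

definition fib_fact :: "nat \<Rightarrow> rat" where
  "fib_fact n = (\<Prod>t<n. of_nat (fib (Suc t)))"

lemma fib_fact_0 [simp]: "fib_fact 0 = 1"
  by (simp add: fib_fact_def)

lemma fib_fact_Suc: "fib_fact (Suc n) = of_nat (fib (Suc n)) * fib_fact n"
  by (simp add: fib_fact_def)

lemma fib_fact_neq_0 [simp]: "fib_fact n \<noteq> 0"
  by (induction n) (use fib_neq_0 in \<open>auto simp: fib_fact_Suc\<close>)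

lemma prod_fib_shift: "(\<Prod>l<n. of_nat (fib (Suc (l + k)))) = fib_fact (n + k) / fib_fact k"
  by (induction n) (simp_all add: fib_fact_Suc)

lemma fibonomial_0 [simp]: "fibonomial a 0 = 1"
  by (simp add: fibonomial_def)

lemma fibonomial_Suc:
  "fibonomial a (Suc b) = fibonomial a b * of_nat (fib (a - b)) / of_nat (fib (Suc b))"
  by (simp add: fibonomial_def)

lemma fibonomial_eq_0: "a < b \<Longrightarrow> fibonomial a b = 0"
  unfolding fibonomial_def by (rule prod_zero) (auto intro!: bexI[of _ "Suc a"])

lemma fibonomial_add: "fibonomial (a + b) b = fib_fact (a + b) / (fib_fact a * fib_fact b)"
proof -
  \<comment> \<open>The upper index must stay fixed while \<open>b\<close> grows, hence the detour
    through \<open>c - b\<close>.\<close>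
  have "fibonomial c b * fib_fact (c - b) * fib_fact b = fib_fact c" if "b \<le> c" for c
    using that
  proof (induction b)
    case (Suc b)
    then have "c - b = Suc (c - Suc b)" by simp
    then have "fib_fact (c - b) = of_nat (fib (c - b)) * fib_fact (c - Suc b)"
      by (metis fib_fact_Suc)
    with Suc show ?case
      using fib_neq_0[of "Suc b"] by (simp add: fibonomial_Suc fib_fact_Suc field_simps)
  qed simp
  from this[of "a + b"] show ?thesis by (simp add: field_simps)
qed

text \<open>A Pascal-type recurrence with integer coefficients, from which integrality follows. It
  is the addition theorem for \<open>fib (Suc a)\<close>, multiplied by a common quotient of
  Fibonacci factorials.\<close>

lemma fibonomial_Suc_Suc:
  assumes "b < a"
  shows "fibonomial (Suc a) (Suc b)
    = of_nat (fib (a - b - 1)) * fibonomial a b + of_nat (fib (b + 2)) * fibonomial a (Suc b)"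
proof -
  obtain d where a: "a = Suc (d + b)"
    using assms less_iff_Suc_add[of b a] by (auto simp: add.commute)
  have "fib (Suc a) = fib d * fib (Suc b) + fib (b + 2) * fib (Suc d)"
    using fib_add[of "Suc b" d] by (simp add: a add.commute)
  then have f: "(of_nat (fib (Suc a)) :: rat)
      = of_nat (fib d) * of_nat (fib (Suc b)) + of_nat (fib (b + 2)) * of_nat (fib (Suc d))"
    by (metis of_nat_add of_nat_mult)
  have "fibonomial (Suc a) (Suc b) = fib_fact (Suc a) / (fib_fact (Suc d) * fib_fact (Suc b))"
    using fibonomial_add[of "Suc d" "Suc b"] by (simp add: a)
  moreover have "fibonomial a b = fib_fact a / (fib_fact (Suc d) * fib_fact b)"
    using fibonomial_add[of "Suc d" b] by (simp add: a)
  moreover have "fibonomial a (Suc b) = fib_fact a / (fib_fact d * fib_fact (Suc b))"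
    using fibonomial_add[of d "Suc b"] by (simp add: a)
  moreover have "a - b - 1 = d" by (simp add: a)
  ultimately show ?thesis
    using fib_neq_0[of "Suc b"] fib_neq_0[of "Suc d"]
    by (simp only: fib_fact_Suc f) (simp add: field_simps del: fib.simps)
qed

lemma fibonomial_self: "fibonomial a a = 1"
  using fibonomial_add[of 0 a] by simp

lemma fibonomial_in_Ints: "fibonomial a b \<in> \<int>"
proof (induction a arbitrary: b)
  case 0
  then show ?case by (cases b) (simp_all add: fibonomial_eq_0)
next
  case (Suc a)
  show ?case
  proof (cases b)
    case (Suc c)
    consider "c < a" | "c = a" | "c > a" by linarith
    then show ?thesis
    proof cases
      case 1
      then show ?thesis
        unfolding Suc fibonomial_Suc_Suc[OF 1] by (intro Ints_add Ints_mult Suc.IH Ints_of_nat)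
    qed (simp_all add: Suc fibonomial_self fibonomial_eq_0)
  qed simp
qed

lemma W_entry_in_Ints: "W_entry n i j \<in> \<int>"
  unfolding W_entry_def by (intro Ints_mult Ints_power fibonomial_in_Ints) auto

subsection \<open>The inverse matrix\<close>

text \<open>The Lagrange weight of \<open>fib_col k\<close>, scaled by all brackets with the rows;
  dividing by two of these brackets gives terms to which the Lagrange identity applies. As the
  reciprocal matrix is symmetric, one family of weights serves rows and columns.\<close>

definition cauchy_weight :: "nat \<Rightarrow> nat \<Rightarrow> rat" where
  "cauchy_weight n k = (\<Prod>l<n. bracket (fib_row l) (fib_col k))
     / (\<Prod>m\<in>{..<n} - {k}. bracket (fib_col k) (fib_col m))"

text \<open>Split at \<open>m = k\<close>: the factors with \<open>m < k\<close> have signs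
  \<open>(- 1) ^ Suc m\<close>, those with \<open>m > k\<close> all have sign
  \<open>(- 1) ^ k\<close>.\<close>

lemma prod_bracket_fib_col:
  "(\<Prod>m\<in>{..<Suc (k + d)} - {k}. bracket (fib_col k) (fib_col m))
    = (- 1) ^ (k * (Suc (k + d)) + (Suc k choose 2)) * fib_fact k * fib_fact d"
proof -
  have lower: "(\<Prod>m<j. bracket (fib_col k) (fib_col m))
      = (- 1) ^ (Suc j choose 2) * (fib_fact k / fib_fact (k - j))" if "j \<le> k" for j
    using that
  proof (induction j)
    case (Suc j)
    have k: "k - j = Suc (k - Suc j)" using Suc.prems by simp
    have "bracket (fib_col k) (fib_col j) = (- 1) ^ Suc j * of_nat (fib (k - j))"
      using bracket_fib_row_row[of j "k - j"] Suc.prems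
      by (simp add: bracket_fib_col_col bracket_swap[of "fib_row k"])
    moreover have "fib_fact (k - j) = of_nat (fib (k - j)) * fib_fact (k - Suc j)"
      by (metis k fib_fact_Suc)
    moreover have "Suc (Suc j) choose 2 = (Suc j choose 2) + Suc j"
      by (simp add: numeral_2_eq_2)
    ultimately show ?case
      using Suc fib_neq_0[of "k - j"] by (simp add: power_add del: fib.simps)
  qed (simp add: numeral_2_eq_2)
  have upper: "(\<Prod>m\<in>{Suc k..<Suc (k + d)}. bracket (fib_col k) (fib_col m))
      = (- 1) ^ (k * d) * fib_fact d"
  proof (induction d)
    case (Suc d)
    have "bracket (fib_col k) (fib_col (Suc (k + d))) = (- 1) ^ k * of_nat (fib (Suc d))"
      using bracket_fib_row_row[of k "Suc d"] by (simp add: bracket_fib_col_col)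
    with Suc show ?case
      by (simp add: fib_fact_Suc power_add del: fib.simps)
  qed simp
  have eq: "{..<Suc (k + d)} - {k} = {..<k} \<union> {Suc k..<Suc (k + d)}" by auto
  have "(\<Prod>m\<in>{..<Suc (k + d)} - {k}. bracket (fib_col k) (fib_col m))
      = (\<Prod>m<k. bracket (fib_col k) (fib_col m))
        * (\<Prod>m\<in>{Suc k..<Suc (k + d)}. bracket (fib_col k) (fib_col m))"
    unfolding eq by (rule prod.union_disjoint) auto
  also have "\<dots> = (- 1) ^ (Suc k choose 2) * fib_fact k * ((- 1) ^ (k * d) * fib_fact d)"
    unfolding upper using lower[of k] by simp
  finally have "(\<Prod>m\<in>{..<Suc (k + d)} - {k}. bracket (fib_col k) (fib_col m))
      = (- 1) ^ (Suc k choose 2) * fib_fact k * ((- 1) ^ (k * d) * fib_fact d)" .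
  \<comment> \<open>The exponent is stated with \<open>k * n\<close>, where
    \<open>n = Suc (k + d)\<close>, to match \<open>W_exponent\<close>; it differs from
    \<open>k * d\<close> by an even number.\<close>
  moreover have "(- 1 :: rat) ^ (k * Suc (k + d)) = (- 1) ^ (k * d)"
  proof -
    have "k * Suc (k + d) = k * Suc k + k * d" by (simp add: algebra_simps)
    moreover have "even (k * Suc k)" by simp
    ultimately show ?thesis by (simp add: power_add del: mult_Suc_right)
  qed
  ultimately show ?thesis by (simp only: power_add mult_ac)
qed

lemma cauchy_weight_eq:
  assumes "k < n"
  shows "cauchy_weight n k = (- 1) ^ (k * n + (Suc k choose 2))
    * fib_fact (n + k) / ((fib_fact k)\<^sup>2 * fib_fact (n - Suc k))"
proof -
  obtain d where n: "n = Suc (k + d)"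
    using assms less_iff_Suc_add by blast
  have "(\<Prod>l<n. bracket (fib_row l) (fib_col k)) = fib_fact (n + k) / fib_fact k"
    by (simp only: bracket_fib_row_col prod_fib_shift)
  moreover have "n - Suc k = d" by (simp add: n)
  ultimately show ?thesis
    unfolding cauchy_weight_def n prod_bracket_fib_col
    \<comment> \<open>The sign stands in the denominator; fixing its parity lets it move to the
      numerator.\<close>
    by (cases "even (k * Suc (k + d) + (Suc k choose 2))") (simp_all add: power2_eq_square)
qed

text \<open>The outer fibonomials contribute \<open>fib_fact (Suc (i + j))\<close> squared below,
  the inner one \<open>fib_fact (i + j)\<close> squared above. With the factor
  \<open>fib (Suc (i + j))\<close> exactly one such factor remains in the denominator.\<close>

lemma W_entry_eq:
  assumes "i < n" "j < n"
  shows "W_entry n (i + 1) (j + 1)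
    = (- 1) ^ Suc n * cauchy_weight n i * cauchy_weight n j / of_nat (fib (Suc (i + j)))"
proof -
  obtain a where a: "n = Suc (i + a)"
    using assms less_iff_Suc_add by blast
  obtain b where b: "n = Suc (j + b)"
    using assms less_iff_Suc_add by blast
  have "fibonomial (n + i) (n - Suc j) = fib_fact (n + i) / (fib_fact (Suc (i + j)) * fib_fact b)"
    using fibonomial_add[of "Suc (i + j)" b] by (simp add: b add_ac)
  moreover have
    "fibonomial (n + j) (n - Suc i) = fib_fact (n + j) / (fib_fact (Suc (i + j)) * fib_fact a)"
    using fibonomial_add[of "Suc (i + j)" a] by (simp add: a add_ac)
  moreover have "fibonomial (i + j) i = fib_fact (i + j) / (fib_fact j * fib_fact i)"
    using fibonomial_add[of j i] by (simp add: add.commute)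
  moreover have "(- 1 :: rat) ^ W_exponent n (i + 1) (j + 1)
      = (- 1) ^ Suc n * (- 1) ^ (i * n + (Suc i choose 2)) * (- 1) ^ (j * n + (Suc j choose 2))"
  proof -
    have "W_exponent n (i + 1) (j + 1)
        = Suc n + (i * n + (Suc i choose 2)) + (j * n + (Suc j choose 2)) + 2 * n"
      by (simp add: W_exponent_def algebra_simps)
    then show ?thesis
      by (simp only: power_add power_mult) simp
  qed
  moreover have "n - Suc i = a" using a by simp
  moreover have "n - Suc j = b" using b by simp
  ultimately show ?thesis
    using fib_neq_0[of "Suc (i + j)"]
    unfolding cauchy_weight_eq[OF assms(1)] cauchy_weight_eq[OF assms(2)] W_entry_def
    by (simp add: power2_eq_square fib_fact_Suc del: fib.simps power_Suc) (simp only: mult_ac)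
qed

text \<open>The two divisions remove rows \<open>i\<close> and \<open>j\<close> from the numerator,
  leaving \<open>n - 2\<close> factors for \<open>n\<close> points.\<close>

lemma sum_cauchy_weight_off_diagonal:
  assumes "i < n" "j < n" "i \<noteq> j"
  shows "(\<Sum>k<n. cauchy_weight n k / (of_nat (fib (Suc (i + k))) * of_nat (fib (Suc (j + k))))) = 0"
proof -
  let ?L = "{..<n} - {i} - {j}"
  have "cauchy_weight n k / (of_nat (fib (Suc (i + k))) * of_nat (fib (Suc (j + k))))
      = (\<Prod>l\<in>?L. bracket (fib_row l) (fib_col k))
        / (\<Prod>m\<in>{..<n} - {k}. bracket (fib_col k) (fib_col m))" for k
  proof -
    have "(\<Prod>l<n. bracket (fib_row l) (fib_col k))
        = of_nat (fib (Suc (i + k))) * (\<Prod>l\<in>{..<n} - {i}. bracket (fib_row l) (fib_col k))"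
      using assms by (simp only: prod.remove[of "{..<n}" i] bracket_fib_row_col finite_lessThan lessThan_iff)
    also have "(\<Prod>l\<in>{..<n} - {i}. bracket (fib_row l) (fib_col k))
        = of_nat (fib (Suc (j + k))) * (\<Prod>l\<in>?L. bracket (fib_row l) (fib_col k))"
      using assms by (subst prod.remove[of _ j]) (auto simp: bracket_fib_row_col)
    finally show ?thesis
      using fib_neq_0[of "Suc (i + k)"] fib_neq_0[of "Suc (j + k)"]
      by (simp add: cauchy_weight_def del: fib.simps)
  qed
  moreover have "(\<Sum>k<n. (\<Prod>l\<in>?L. bracket (fib_row l) (fib_col k))
      / (\<Prod>m\<in>{..<n} - {k}. bracket (fib_col k) (fib_col m))) = 0"
    using assms
    by (intro sum_bracket_quotient_eq_0)
      (auto simp: bracket_fib_col_col bracket_fib_row_row_neq_0)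
  ultimately show ?thesis by simp
qed

lemma sum_cauchy_weight_diagonal:
  assumes "j < n"
  shows "cauchy_weight n j * (\<Sum>k<n. cauchy_weight n k / (of_nat (fib (Suc (j + k))))\<^sup>2)
    = (- 1) ^ Suc n"
proof -
  let ?L = "{..<n} - {j}"
  \<comment> \<open>Only one row can be removed here, so \<open>fib_row j\<close> joins as point
    number \<open>n\<close>: \<open>n + 1\<close> points against \<open>n - 1\<close>
    factors.\<close>
  let ?v = "\<lambda>k. if k < n then fib_col k else fib_row j"
  define B where "B k = (\<Prod>m\<in>{..<n} - {k}. bracket (fib_col k) (fib_col m))" for k
  define S where "S = (\<Sum>k<n. cauchy_weight n k / (of_nat (fib (Suc (j + k))))\<^sup>2)"
  have bracket_neq_0: "bracket (fib_row j) (fib_col k) \<noteq> 0" for k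
    using fib_neq_0[of "Suc (j + k)"] by (simp add: bracket_fib_row_col del: fib.simps)
  have "(\<Sum>k<Suc n. (\<Prod>l\<in>?L. bracket (fib_row l) (?v k))
      / (\<Prod>m\<in>{..<Suc n} - {k}. bracket (?v k) (?v m))) = 0"
    using assms bracket_neq_0
    by (intro sum_bracket_quotient_eq_0)
      (auto simp: bracket_fib_col_col bracket_fib_row_row_neq_0 bracket_swap[of _ "fib_row j"])
  moreover have "(\<Prod>l\<in>?L. bracket (fib_row l) (?v k))
      / (\<Prod>m\<in>{..<Suc n} - {k}. bracket (?v k) (?v m))
      = - (cauchy_weight n k / (of_nat (fib (Suc (j + k))))\<^sup>2)" if "k < n" for k
  proof -
    \<comment> \<open>The new point adds the denominator factor
      \<open>bracket (fib_col k) (fib_row j)\<close>, which supplies the second Fibonacci factor of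
      the square and the minus sign.\<close>
    have "{..<Suc n} - {k} = insert n ({..<n} - {k})" using that by auto
    then have "(\<Prod>m\<in>{..<Suc n} - {k}. bracket (?v k) (?v m))
        = bracket (fib_col k) (fib_row j) * B k"
      using that by (simp add: B_def)
    moreover have "(\<Prod>l<n. bracket (fib_row l) (fib_col k))
        = bracket (fib_row j) (fib_col k) * (\<Prod>l\<in>?L. bracket (fib_row l) (fib_col k))"
      using assms by (intro prod.remove) auto
    ultimately show ?thesis
      using that bracket_neq_0[of k]
      by (simp add: cauchy_weight_def power2_eq_square bracket_swap[of _ "fib_row j"]
          del: fib.simps flip: B_def bracket_fib_row_col)
  qed
  moreover have "{..<Suc n} - {n} = {..<n}" by auto
  ultimately have "(\<Prod>l\<in>?L. bracket (fib_row l) (fib_row j))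
      / (\<Prod>m<n. bracket (fib_row j) (fib_col m)) = S"
    by (simp add: S_def sum_negf)
  \<comment> \<open>In the term of the new point the numerator becomes, after \<open>n - 1\<close>
    sign changes, the denominator \<open>B j\<close> of the weight at \<open>j\<close>, so that
    weight cancels the term up to sign.\<close>
  moreover have "(\<Prod>l\<in>?L. bracket (fib_row l) (fib_row j)) = (- 1) ^ (n - 1) * B j"
  proof -
    have "(\<Prod>l\<in>?L. bracket (fib_row l) (fib_row j))
        = (\<Prod>l\<in>?L. - 1 * bracket (fib_col j) (fib_col l))"
      by (simp add: bracket_fib_col_col bracket_swap[of _ "fib_row j"])
    also have "\<dots> = (- 1) ^ (n - 1) * B j"
      using assms by (simp only: prod.distrib B_def) simp
    finally show ?thesis .
  qed
  moreover have "cauchy_weight n j = (\<Prod>m<n. bracket (fib_row j) (fib_col m)) / B j"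
    unfolding cauchy_weight_def B_def by (simp only: bracket_fib_row_col add.commute[of j])
  moreover have "B j \<noteq> 0"
    by (auto simp: B_def bracket_fib_col_col bracket_fib_row_row_neq_0)
  moreover have "(\<Prod>m<n. bracket (fib_row j) (fib_col m)) \<noteq> 0"
    using bracket_neq_0 by simp
  moreover have "(- 1 :: rat) ^ Suc n = (- 1) ^ (n - 1)"
    using assms by (cases n) simp_all
  ultimately have "cauchy_weight n j * S = (- 1) ^ Suc n"
    by (auto simp flip: \<open>_ = S\<close>)
  then show ?thesis by (simp only: S_def)
qed

lemma R_mat_times_W_mat: "R_mat n * W_mat n = 1\<^sub>m n"
proof (rule eq_matI)
  fix i j assume "i < dim_row (1\<^sub>m n)" "j < dim_col (1\<^sub>m n)"
  then have ij: "i < n" "j < n" by simp_all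
  have "(R_mat n * W_mat n) $$ (i, j)
      = (\<Sum>k<n. 1 / of_nat (fib (Suc (i + k))) * W_entry n (k + 1) (j + 1))"
    using ij by (simp add: R_mat_def W_mat_def scalar_prod_def lessThan_atLeast0)
  also have "\<dots> = (\<Sum>k<n. (- 1) ^ Suc n * cauchy_weight n j
      * (cauchy_weight n k / (of_nat (fib (Suc (i + k))) * of_nat (fib (Suc (j + k))))))"
    using ij by (intro sum.cong) (simp_all only: W_entry_eq lessThan_iff, simp add: add.commute)
  also have "\<dots> = (- 1) ^ Suc n * (cauchy_weight n j * (\<Sum>k<n. cauchy_weight n k
      / (of_nat (fib (Suc (i + k))) * of_nat (fib (Suc (j + k))))))"
    by (simp only: sum_distrib_left mult.assoc)
  also have "\<dots> = (if i = j then 1 else 0)"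
  proof (cases "i = j")
    case True
    then show ?thesis
      using sum_cauchy_weight_diagonal[OF ij(2)]
      \<comment> \<open>The sign from \<open>W_entry_eq\<close> meets the equal sign of the diagonal
        sum, and their product is 1.\<close>
      by (simp only: power2_eq_square) (simp flip: power_mult_distrib)
  next
    case False
    then show ?thesis
      using sum_cauchy_weight_off_diagonal[OF ij False] by simp
  qed
  finally show "(R_mat n * W_mat n) $$ (i, j) = 1\<^sub>m n $$ (i, j)"
    using ij by simp
qed (simp_all add: R_mat_def W_mat_def)

theorem theorem2p1:
  fixes n :: nat
  assumes "n \<ge> 1"
  shows "inverts_mat (R_mat n) (W_mat n) \<and> inverts_mat (W_mat n) (R_mat n)
    \<and> (\<forall>i < n. \<forall>j < n. W_mat n $$ (i, j) \<in> \<int>)"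
proof -
  have "R_mat n \<in> carrier_mat n n" "W_mat n \<in> carrier_mat n n"
    by (simp_all add: R_mat_def W_mat_def)
  then have "W_mat n * R_mat n = 1\<^sub>m n"
    using mat_mult_left_right_inverse R_mat_times_W_mat by blast
  then show ?thesis
    using R_mat_times_W_mat
    by (simp add: inverts_mat_def R_mat_def W_mat_def W_entry_in_Ints)
qed

end
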